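(* Let $\mathcal{S}=\langle\mathcal{L},\vdash\rangle$ be a logic, with $\mathcal{L}$ a formula algebra over a denumerable set of variables $V$. Then its pure right variable inclusion companion $\mathcal{S}^{pr}=\langle\mathcal{L},\vdash^{pr}\rangle$ is NF-paraconsistent.
   Context: A logic is a pair $\langle\mathcal{L},\vdash\rangle$ with $\vdash\,\subseteq\mathcal{P}(\mathcal{L})\times\mathcal{L}$, and $C_\vdash(\Gamma)=\{\alpha:\Gamma\vdash\alpha\}$. $\mathcal{L}$ is the formula algebra over a denumerable set $V$ of variables in a finite signature. $\mathrm{var}(\alpha)$ is the set of variables in $\alpha$; $\mathrm{var}(\Gamma)=\bigcup_{\alpha\in\Gamma}\mathrm{var}(\alpha)$. $\Gamma\vdash^{pr}\alpha$ iff $\Gamma\vdash\alpha$ and $\mathrm{var}(\alpha)\subseteq\mathrm{var}(\Gamma)$. A logic is NF-paraconsistent if there exists $\alpha\in\mathcal{L}$ such that $C_\vdash(\{\alpha,\beta\})\neq\mathcal{L}$ for every $\beta\in\mathcal{L}$. *)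

theory Defs
  imports Main "HOL-Library.Countable_Set"
begin

datatype ('f, var: 'v) fm = Var 'v | Op 'f "('f, 'v) fm list"

text \<open>
  The universe of the formula algebra over the variables \<open>V\<close> in the signature with operation
  symbols \<open>F\<close> and arities \<open>ar\<close>. The type \<open>fm\<close> itself also contains terms that violate the
  arities or use symbols outside \<open>F\<close> and \<open>V\<close>.
\<close>

inductive_set formulas :: "'f set \<Rightarrow> ('f \<Rightarrow> nat) \<Rightarrow> 'v set \<Rightarrow> ('f, 'v) fm set"
  for F :: "'f set" and ar :: "'f \<Rightarrow> nat" and V :: "'v set" where
  Var: "x \<in> V \<Longrightarrow> Var x \<in> formulas F ar V"
| Op: "f \<in> F \<Longrightarrow> length ts = ar f \<Longrightarrow> (\<And>t. t \<in> set ts \<Longrightarrow> t \<in> formulas F ar V)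
    \<Longrightarrow> Op f ts \<in> formulas F ar V"

definition vars :: "('f, 'v) fm set \<Rightarrow> 'v set" where
  "vars \<Gamma> = (\<Union>\<alpha>\<in>\<Gamma>. var \<alpha>)"

definition is_logic :: "'a set \<Rightarrow> ('a set \<times> 'a) set \<Rightarrow> bool" where
  "is_logic L E \<longleftrightarrow> E \<subseteq> Pow L \<times> L"

definition Cn :: "('a set \<times> 'a) set \<Rightarrow> 'a set \<Rightarrow> 'a set" where
  "Cn E \<Gamma> = {\<alpha>. (\<Gamma>, \<alpha>) \<in> E}"

definition pr :: "(('f, 'v) fm set \<times> ('f, 'v) fm) set \<Rightarrow> (('f, 'v) fm set \<times> ('f, 'v) fm) set" where
  "pr E = {(\<Gamma>, \<alpha>). (\<Gamma>, \<alpha>) \<in> E \<and> var \<alpha> \<subseteq> vars \<Gamma>}"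

definition NF_paraconsistent :: "'a set \<Rightarrow> ('a set \<times> 'a) set \<Rightarrow> bool" where
  "NF_paraconsistent L E \<longleftrightarrow> (\<exists>\<alpha>\<in>L. \<forall>\<beta>\<in>L. Cn E {\<alpha>, \<beta>} \<noteq> L)"

lemma is_logic_pr: "is_logic L E \<Longrightarrow> is_logic L (pr E)"
  by (auto simp: is_logic_def pr_def)

end

theory Submission
  imports Defs
begin

lemma finite_var: "finite (var \<alpha>)"
  by (induction \<alpha>) auto

lemma finite_vars: "finite \<Gamma> \<Longrightarrow> finite (vars \<Gamma>)"
  by (simp add: vars_def finite_var)

lemma var_subset_if_formulas: "\<alpha> \<in> formulas F ar V \<Longrightarrow> var \<alpha> \<subseteq> V"
  by (induction rule: formulas.induct) auto

lemma vars_formulas: "vars (formulas F ar V) = V"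
proof
  show "vars (formulas F ar V) \<subseteq> V"
    unfolding vars_def by (rule UN_least) (rule var_subset_if_formulas)
  show "V \<subseteq> vars (formulas F ar V)"
  proof
    fix x assume "x \<in> V"
    then have "Var x \<in> formulas F ar V"
      by (rule formulas.Var)
    then show "x \<in> vars (formulas F ar V)"
      unfolding vars_def by (rule UN_I) simp
  qed
qed

lemma vars_Cn_pr_subset: "vars (Cn (pr E) \<Gamma>) \<subseteq> vars \<Gamma>"
  by (auto simp: vars_def Cn_def pr_def)

lemma Cn_pr_neq_if_finite:
  assumes "infinite (vars L)" and "finite \<Gamma>"
  shows "Cn (pr E) \<Gamma> \<noteq> L"
proof
  assume "Cn (pr E) \<Gamma> = L"
  then have "vars L \<subseteq> vars \<Gamma>"
    using vars_Cn_pr_subset by metis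
  moreover have "finite (vars \<Gamma>)"
    using \<open>finite \<Gamma>\<close> by (rule finite_vars)
  ultimately have "finite (vars L)"
    by (rule finite_subset)
  with \<open>infinite (vars L)\<close> show False ..
qed

lemma NF_paraconsistent_pr:
  assumes "infinite (vars L)"
  shows "NF_paraconsistent L (pr E)"
proof -
  have "L \<noteq> {}"
    using assms by (auto simp: vars_def)
  then obtain \<alpha> where "\<alpha> \<in> L"
    by blast
  moreover have "Cn (pr E) {\<alpha>, \<beta>} \<noteq> L" for \<beta>
    using assms by (rule Cn_pr_neq_if_finite) simp
  ultimately show ?thesis
    unfolding NF_paraconsistent_def by blast
qed

theorem theorem2p25:
  fixes F :: "'f set" and ar :: "'f \<Rightarrow> nat" and V :: "'v set"
    and E :: "(('f, 'v) fm set \<times> ('f, 'v) fm) set"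
  assumes "finite F"
    and "countable V" and "infinite V"
    and "is_logic (formulas F ar V) E"
  shows "NF_paraconsistent (formulas F ar V) (pr E)"
proof (rule NF_paraconsistent_pr)
  show "infinite (vars (formulas F ar V))"
    using \<open>infinite V\<close> by (simp add: vars_formulas)
qed

end
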